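(* Let $a\in L^\infty_{\mathrm{loc}}([0,\infty))$ with $a(x)\ge0$ for almost all $x>0$, and let $b:(0,\infty)^2\to[0,\infty)$ be measurable with $b(x,y)=0$ for almost all $x,y$ with $x>y$. Assume that one of the following two statements is true: (i) $b$ is bounded on $[0,\eta]^2$ for every $\eta>0$ (in this case set $\eta_0=0$); (ii) there exists $\eta_0>0$ such that $b$ is bounded on $[\eta_0,\eta]^2$ for every $\eta>\eta_0$, and there exists $\omega_0\in L^\infty(0,\eta_0)$ such that $\omega_0(x)\ge0$ for almost every $x\in[0,\eta_0]$ and $y\mapsto\int_0^{\eta_0}b(x,y)\omega_0(x)\,\mathrm{d}x$ is locally bounded on $[\eta_0,\infty)$. Let $\kappa>0$. Then there exists a function $\omega:[0,\infty)\to[0,\infty)$ such that $\omega(x)=\omega_0(x)$ for $x\in[0,\eta_0)$, $\omega$ is continuous on $[\eta_0,\infty)$, $\omega(x)>0$ for $x>\eta_0$, and $$\int_0^y b(x,y)\omega(x)\,\mathrm{d}x\le\kappa\,\omega(y)\qquad\text{for } y\in[\eta_0,\infty).$$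
   Context: Since $b$ is defined on $(0,\infty)^2$, conditions on sets touching the coordinate axes refer to points with positive coordinates (e.g. in (i), $b$ is bounded on $(0,\eta]^2$). In case (i), $\eta_0=0$, so the condition $\omega=\omega_0$ on $[0,\eta_0)=\emptyset$ is vacuous and no $\omega_0$ is needed. In case (ii), $\omega_0$ is an $L^\infty$ function, so the equality $\omega=\omega_0$ refers to a non-negative representative of $\omega_0$. *)

theory Defs
  imports "HOL-Analysis.Analysis"
begin

text \<open>
  Elements of \<open>L\<^sup>\<infinity>\<close> spaces are handled through representatives, i.e. total functions that are
  only constrained on the set \<open>S\<close>.
\<close>

definition Linfty :: "real set \<Rightarrow> (real \<Rightarrow> real) set" where
  "Linfty S = {f. f \<in> borel_measurable (lebesgue_on S) \<and>
                  (\<exists>C. AE x in lebesgue_on S. \<bar>f x\<bar> \<le> C)}"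

definition Linfty_loc :: "real set \<Rightarrow> (real \<Rightarrow> real) set" where
  "Linfty_loc S = {f. \<forall>K. compact K \<and> K \<subseteq> S \<longrightarrow> f \<in> Linfty K}"

text \<open>Local boundedness for functions with values in \<open>[0,\<infinity>]\<close>; the bounds are finite.\<close>

definition locally_bounded_on :: "real set \<Rightarrow> (real \<Rightarrow> ennreal) \<Rightarrow> bool" where
  "locally_bounded_on S f \<longleftrightarrow>
     (\<forall>K. compact K \<and> K \<subseteq> S \<longrightarrow> (\<exists>C::real. \<forall>y\<in>K. f y \<le> ennreal C))"

definition nonneg_representative :: "real set \<Rightarrow> (real \<Rightarrow> real) \<Rightarrow> (real \<Rightarrow> real) \<Rightarrow> bool" where
  "nonneg_representative S f w \<longleftrightarrow>
     (\<forall>x\<in>S. 0 \<le> w x) \<and> (AE x in lebesgue_on S. w x = f x)"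

text \<open>
  Quantifying over all non-negative representatives is therefore never vacuous for a function that
  is non-negative almost everywhere.
\<close>

lemma nonneg_representative_exists:
  assumes "AE x in lebesgue_on S. 0 \<le> f x"
  shows "nonneg_representative S f (\<lambda>x. max 0 (f x))"
  using assms unfolding nonneg_representative_def by auto

text \<open>
  The integral of the non-negative function \<open>b(\<cdot>, y) w\<close> over \<open>(0, u)\<close>
  is taken in \<open>[0,\<infinity>]\<close>, so that an upper bound on it includes its finiteness. A Lebesgue
  measurable \<open>b\<close> may have non-measurable sections \<open>b(\<cdot>, y)\<close> for a null set of \<open>y\<close>; for these the
  library's non-negative integral is the lower integral.
\<close>

definition weighted_integral ::
    "(real \<times> real \<Rightarrow> real) \<Rightarrow> (real \<Rightarrow> real) \<Rightarrow> real \<Rightarrow> real \<Rightarrow> ennreal" where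
  "weighted_integral b w u y = (\<integral>\<^sup>+x\<in>{0<..<u}. ennreal (b (x, y) * w x) \<partial>lebesgue)"

end

theory Submission
  imports Defs
begin

text \<open>
  Let \<open>N\<close> be continuous and positive on \<open>[\<eta>\<^sub>0, \<infinity>)\<close> with \<open>N y\<close> bounding both the given integral of
  \<open>b(\<cdot>, y) \<omega>\<^sub>0\<close> over \<open>(0, \<eta>\<^sub>0)\<close> and the values \<open>b(x, y)\<close> for \<open>\<eta>\<^sub>0 \<le> x \<le> y\<close>. Then it suffices that
  \<open>\<kappa> \<omega>(y) = N(y) (1 + \<integral> \<omega>)\<close>, the integral being over \<open>[\<eta>\<^sub>0, y]\<close>. This is a linear equation for
  \<open>W = 1 + \<integral> \<omega>\<close>, solved by \<open>W = exp (\<integral> N / \<kappa>)\<close>, so that \<open>\<omega> = N W / \<kappa>\<close>.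
\<close>

text \<open>
  For a non-measurable integrand the library's integral is a lower integral, which is not subadditive
  in the integrand but still is over measurable sets.
\<close>

lemma nn_set_integral_Un_le:
  assumes [measurable]: "A \<in> sets M" "B \<in> sets M"
  shows "(\<integral>\<^sup>+x\<in>A \<union> B. f x \<partial>M) \<le> (\<integral>\<^sup>+x\<in>A. f x \<partial>M) + (\<integral>\<^sup>+x\<in>B. f x \<partial>M)"
proof (subst nn_integral_def, rule SUP_least, clarify)
  \<comment> \<open>A simple function below the integrand is measurable even when \<open>f\<close>
    is not, so additivity of the integral applies to it, and its pieces over \<open>A\<close> and
    \<open>B\<close> stay below those of \<open>f\<close>.\<close>
  fix s
  assume s: "simple_function M s" and le: "s \<le> (\<lambda>x. f x * indicator (A \<union> B) x)"
  have [measurable]: "s \<in> borel_measurable M"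
    using s by (rule borel_measurable_simple_function)
  have s_le: "s x \<le> f x * indicator (A \<union> B) x" for x
    using le by (simp add: le_fun_def)
  have "integral\<^sup>S M s = (\<integral>\<^sup>+x. s x \<partial>M)"
    using s by (simp add: nn_integral_eq_simple_integral)
  also have "\<dots> \<le> (\<integral>\<^sup>+x. s x * indicator A x + s x * indicator B x \<partial>M)"
  proof (rule nn_integral_mono)
    fix x show "s x \<le> s x * indicator A x + s x * indicator B x"
      using s_le[of x] by (auto simp: indicator_def)
  qed
  also have "\<dots> = (\<integral>\<^sup>+x\<in>A. s x \<partial>M) + (\<integral>\<^sup>+x\<in>B. s x \<partial>M)"
    by (rule nn_integral_add) measurable
  also have "\<dots> \<le> (\<integral>\<^sup>+x\<in>A. f x \<partial>M) + (\<integral>\<^sup>+x\<in>B. f x \<partial>M)"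
  proof (intro add_mono nn_integral_mono)
    fix x
    show "s x * indicator A x \<le> f x * indicator A x" "s x * indicator B x \<le> f x * indicator B x"
      using s_le[of x] by (auto simp: indicator_def)
  qed
  finally show "integral\<^sup>S M s \<le> (\<integral>\<^sup>+x\<in>A. f x \<partial>M) + (\<integral>\<^sup>+x\<in>B. f x \<partial>M)" .
qed

text \<open>Continuity of indefinite integrals comes from compact intervals. Continuity being local,
  it passes to the ray: \<open>{c..x + 1}\<close> is a neighbourhood of \<open>x\<close> relative to
  \<open>{c..}\<close>.\<close>

lemma continuous_on_atLeast:
  fixes f :: "real \<Rightarrow> 'a::topological_space"
  assumes "\<And>T. continuous_on {c..T} f"
  shows "continuous_on {c..} f"
proof (unfold continuous_on_eq_continuous_within, rule ballI)
  fix x assume x: "x \<in> {c..}"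
  have "continuous (at x within {c..x + 1}) f"
    using assms[of "x + 1"] x by (simp add: continuous_on_eq_continuous_within)
  moreover have "at x within {c..x + 1} = at x within {c..}"
    by (rule at_within_nhd[of x "{..<x + 1}"]) auto
  ultimately show "continuous (at x within {c..}) f"
    by simp
qed

text \<open>\<open>C n\<close> will be a bound valid on [c, c + n]; the index used at
  \<open>y\<close> is the least \<open>n\<close> with \<open>y \<le> c + n\<close>. Averaging an
  increasing step function over [y, y + 1] gives a continuous function that is at least its value at
  \<open>y\<close>.\<close>

lemma continuous_majorant_exists:
  fixes c :: real and C :: "nat \<Rightarrow> real"
  obtains N where "continuous_on {c..} N"
    and "\<And>y. c \<le> y \<Longrightarrow> 0 < N y" and "\<And>y. c \<le> y \<Longrightarrow> C (nat \<lceil>y - c\<rceil>) \<le> N y"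
proof -
  \<comment> \<open>Summing absolute values makes \<open>D\<close> increasing for arbitrary
    \<open>C\<close>; the summand 1 makes it positive.\<close>
  define D where "D n = 1 + (\<Sum>k\<le>n. \<bar>C k\<bar>)" for n
  define G where "G y = D (nat \<lceil>y - c\<rceil>)" for y
  define N where "N y = integral {y..y + 1} G" for y
  have "mono D"
    unfolding D_def by (intro monoI add_left_mono sum_mono2) auto
  then have G_mono: "mono G"
    unfolding G_def mono_def by (meson ceiling_mono diff_right_mono nat_mono)
  have G_int: "G integrable_on {u..v}" for u v
    using G_mono by (intro integrable_on_mono_on) (auto simp: mono_def mono_on_def)
  have N_ge: "G y \<le> N y" for y
  proof -
    have "integral {y..y + 1} (\<lambda>_. G y) \<le> N y"
      unfolding N_def using G_mono by (intro integral_le G_int) (auto simp: mono_def)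
    then show ?thesis by simp
  qed
  have G_pos: "0 < G y" for y
    unfolding G_def D_def by (smt (verit) sum_nonneg abs_ge_zero)
  have G_C: "C (nat \<lceil>y - c\<rceil>) \<le> G y" for y
  proof -
    have "\<bar>C (nat \<lceil>y - c\<rceil>)\<bar> \<le> (\<Sum>k\<le>nat \<lceil>y - c\<rceil>. \<bar>C k\<bar>)"
      by (rule member_le_sum) auto
    then show ?thesis unfolding G_def D_def by linarith
  qed
  have "continuous_on {c..T} N" for T
  proof -
    \<comment> \<open>As a difference of two values of one indefinite integral, \<open>N\<close>
      inherits its continuity. The argument \<open>y + 1\<close> runs up to
      \<open>T + 1\<close>.\<close>
    have N_eq: "N y = integral {c..y + 1} G - integral {c..y} G" if "y \<in> {c..T}" for y
      unfolding N_def
      using that Henstock_Kurzweil_Integration.integral_combine[of c y "y + 1" G] G_int by auto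
    have I: "continuous_on {c..T + 1} (\<lambda>u. integral {c..u} G)"
      by (rule indefinite_integral_continuous_1[OF G_int])
    have "continuous_on {c..T} (\<lambda>y. integral {c..y + 1} G - integral {c..y} G)"
      by (intro continuous_intros continuous_on_compose2[OF I]) auto
    then show ?thesis
      by (rule continuous_on_eq) (simp add: N_eq)
  qed
  then have "continuous_on {c..} N"
    by (rule continuous_on_atLeast)
  moreover have "0 < N y" for y
    using G_pos[of y] N_ge[of y] by linarith
  moreover have "C (nat \<lceil>y - c\<rceil>) \<le> N y" for y
    using G_C[of y] N_ge[of y] by linarith
  ultimately show ?thesis
    using that by blast
qed

text \<open>The \<open>has_integral\<close> clause is the equation \<kappa> \<omega> = N (1 +
  \<integral> \<omega>) solved for the integral, so it also yields integrability of
  \<omega>.\<close>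

lemma linear_integral_equation_solution:
  fixes c \<kappa> :: real and N :: "real \<Rightarrow> real"
  assumes N_cont: "continuous_on {c..} N" and N_pos: "\<And>y. c \<le> y \<Longrightarrow> 0 < N y"
    and \<kappa>: "\<kappa> > 0"
  obtains \<omega> where "continuous_on {c..} \<omega>" and "\<And>y. c \<le> y \<Longrightarrow> 0 < \<omega> y"
    and "\<And>y. c \<le> y \<Longrightarrow> (\<omega> has_integral (\<kappa> * \<omega> y / N y - 1)) {c..y}"
proof -
  define W where "W y = exp (integral {c..y} N / \<kappa>)" for y
  define \<omega> where "\<omega> y = N y * W y / \<kappa>" for y
  \<comment> \<open>The derivative of the exponential, N W / \<kappa>, is \<omega> itself. Hence the
    integral of \<omega> over [c, y] is \<open>W y - W c\<close>, where
    \<open>W c = 1\<close>.\<close>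
  have W_deriv: "(W has_vector_derivative \<omega> x) (at x within {c..y})" if "x \<in> {c..y}" for x y
  proof -
    have "((\<lambda>u. integral {c..u} N) has_real_derivative N x) (at x within {c..y})"
      using that N_cont by (intro integral_has_real_derivative) (auto intro: continuous_on_subset)
    then have "(W has_real_derivative \<omega> x) (at x within {c..y})"
      unfolding W_def \<omega>_def using \<kappa> by (auto intro!: derivative_eq_intros simp: mult_ac)
    then show ?thesis
      by (simp add: has_real_derivative_iff_has_vector_derivative)
  qed
  have "continuous_on {c..T} W" for T
    using W_deriv by (intro continuous_on_vector_derivative)
  then have "continuous_on {c..} W"
    by (rule continuous_on_atLeast)
  then have "continuous_on {c..} \<omega>"
    unfolding \<omega>_def using N_cont \<kappa> by (intro continuous_intros) auto
  moreover have "0 < \<omega> y" if "c \<le> y" for y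
    unfolding \<omega>_def W_def using N_pos[OF that] \<kappa> by simp
  moreover have "(\<omega> has_integral (\<kappa> * \<omega> y / N y - 1)) {c..y}" if "c \<le> y" for y
  proof -
    have "(\<omega> has_integral (W y - W c)) {c..y}"
      using that W_deriv by (intro fundamental_theorem_of_calculus) auto
    moreover have "W c = 1" "\<kappa> * \<omega> y / N y = W y"
      using N_pos[OF that] \<kappa> by (auto simp: W_def \<omega>_def)
    ultimately show ?thesis by simp
  qed
  ultimately show ?thesis
    using that by blast
qed

theorem theorem5p3:
  fixes a :: "real \<Rightarrow> real" and b :: "real \<times> real \<Rightarrow> real"
    and \<eta>0 \<kappa> :: real and \<omega>0 :: "real \<Rightarrow> real"
  assumes a_Linfty_loc: "a \<in> Linfty_loc {0..}"
    and a_nonneg: "AE x in lebesgue_on {0<..}. 0 \<le> a x"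
    and b_measurable: "b \<in> borel_measurable (lebesgue_on ({0<..} \<times> {0<..}))"
    and b_nonneg: "\<And>x y. 0 < x \<Longrightarrow> 0 < y \<Longrightarrow> 0 \<le> b (x, y)"
    and b_zero: "AE p in lebesgue_on ({0<..} \<times> {0<..}). fst p > snd p \<longrightarrow> b p = 0"
    and cases:
      "(\<eta>0 = 0 \<and> (\<forall>\<eta>>0. bounded (b ` ({0<..\<eta>} \<times> {0<..\<eta>}))))
       \<or> (\<eta>0 > 0 \<and> (\<forall>\<eta>>\<eta>0. bounded (b ` ({\<eta>0..\<eta>} \<times> {\<eta>0..\<eta>})))
           \<and> \<omega>0 \<in> Linfty {0<..<\<eta>0}
           \<and> (AE x in lebesgue_on {0..\<eta>0}. 0 \<le> \<omega>0 x)
           \<and> locally_bounded_on {\<eta>0..} (\<lambda>y. weighted_integral b \<omega>0 \<eta>0 y))"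
    and kappa_pos: "\<kappa> > 0"
  shows "\<forall>w. nonneg_representative {0..<\<eta>0} \<omega>0 w \<longrightarrow>
    (\<exists>\<omega> :: real \<Rightarrow> real.
        (\<forall>x\<ge>0. 0 \<le> \<omega> x)
      \<and> (\<forall>x\<in>{0..<\<eta>0}. \<omega> x = w x)
      \<and> continuous_on {\<eta>0..} \<omega>
      \<and> (\<forall>x>\<eta>0. 0 < \<omega> x)
      \<and> (\<forall>y\<ge>\<eta>0. weighted_integral b \<omega> y y \<le> ennreal (\<kappa> * \<omega> y)))"
proof (intro allI impI)
  fix w assume w: "nonneg_representative {0..<\<eta>0} \<omega>0 w"
  have \<eta>0: "0 \<le> \<eta>0" using cases by auto
  have w_nonneg: "0 \<le> w x" if "x \<in> {0..<\<eta>0}" for x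
    using w that by (simp add: nonneg_representative_def)
  have w_AE: "AE x in lebesgue. x \<in> {0..<\<eta>0} \<longrightarrow> w x = \<omega>0 x"
    using w by (simp add: nonneg_representative_def AE_restrict_space_iff)
  \<comment> \<open>Changing the integrand on a null set preserves even the lower integral, so the
    bound assumed for \<open>\<omega>0\<close> holds for each representative
    \<open>w\<close>.\<close>
  have weighted_w: "weighted_integral b w \<eta>0 y = weighted_integral b \<omega>0 \<eta>0 y" for y
    unfolding weighted_integral_def
    by (intro nn_integral_cong_AE eventually_mono[OF w_AE]) (auto simp: indicator_def)
  have "\<exists>C. \<forall>y\<in>{\<eta>0..\<eta>0 + real n}. weighted_integral b w \<eta>0 y \<le> ennreal C \<and>
          (\<forall>x\<in>{\<eta>0..y}. 0 < x \<longrightarrow> b (x, y) \<le> C)" for n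
  proof -
    \<comment> \<open>If \<open>\<eta>0 = 0\<close>, the integral is over an empty set and
      vanishes.\<close>
    have "\<exists>C1. \<forall>y\<in>{\<eta>0..\<eta>0 + real n}. weighted_integral b w \<eta>0 y \<le> ennreal C1"
      using cases
    proof
      assume "\<eta>0 = 0 \<and> (\<forall>\<eta>>0. bounded (b ` ({0<..\<eta>} \<times> {0<..\<eta>})))"
      then show ?thesis by (simp add: weighted_integral_def)
    next
      assume "\<eta>0 > 0 \<and> (\<forall>\<eta>>\<eta>0. bounded (b ` ({\<eta>0..\<eta>} \<times> {\<eta>0..\<eta>})))
           \<and> \<omega>0 \<in> Linfty {0<..<\<eta>0}
           \<and> (AE x in lebesgue_on {0..\<eta>0}. 0 \<le> \<omega>0 x)
           \<and> locally_bounded_on {\<eta>0..} (\<lambda>y. weighted_integral b \<omega>0 \<eta>0 y)"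
      then show ?thesis
        unfolding locally_bounded_on_def weighted_w
        by (elim conjE allE[of _ "{\<eta>0..\<eta>0 + real n}"]) auto
    qed
    then obtain C1 where C1: "\<forall>y\<in>{\<eta>0..\<eta>0 + real n}. weighted_integral b w \<eta>0 y \<le> ennreal C1" ..
    \<comment> \<open>The intersection with \<open>{0<..}\<close> serves both cases at once: it
      removes the axes if \<open>\<eta>0 = 0\<close> and nothing otherwise. The added 1 keeps the
      right end strictly above \<open>\<eta>0\<close> when \<open>n = 0\<close>.\<close>
    have "bounded (b ` (({\<eta>0..\<eta>0 + real n + 1} \<inter> {0<..}) \<times> ({\<eta>0..\<eta>0 + real n + 1} \<inter> {0<..})))"
      using cases
    proof
      assume "\<eta>0 = 0 \<and> (\<forall>\<eta>>0. bounded (b ` ({0<..\<eta>} \<times> {0<..\<eta>})))"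
      then have "bounded (b ` ({0<..\<eta>0 + real n + 1} \<times> {0<..\<eta>0 + real n + 1}))" by simp
      then show ?thesis by (rule bounded_subset) auto
    next
      assume "\<eta>0 > 0 \<and> (\<forall>\<eta>>\<eta>0. bounded (b ` ({\<eta>0..\<eta>} \<times> {\<eta>0..\<eta>})))
           \<and> \<omega>0 \<in> Linfty {0<..<\<eta>0}
           \<and> (AE x in lebesgue_on {0..\<eta>0}. 0 \<le> \<omega>0 x)
           \<and> locally_bounded_on {\<eta>0..} (\<lambda>y. weighted_integral b \<omega>0 \<eta>0 y)"
      then have "bounded (b ` ({\<eta>0..\<eta>0 + real n + 1} \<times> {\<eta>0..\<eta>0 + real n + 1}))" by simp
      then show ?thesis by (rule bounded_subset) auto
    qed
    then obtain C2 where C2: "\<And>x y. x \<in> {\<eta>0..\<eta>0 + real n + 1} \<Longrightarrow> 0 < x \<Longrightarrow>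
        y \<in> {\<eta>0..\<eta>0 + real n + 1} \<Longrightarrow> 0 < y \<Longrightarrow> \<bar>b (x, y)\<bar> \<le> C2"
      unfolding bounded_iff by force
    show ?thesis
    proof (intro exI[of _ "max C1 C2"] ballI conjI impI)
      fix y assume y: "y \<in> {\<eta>0..\<eta>0 + real n}"
      show "weighted_integral b w \<eta>0 y \<le> ennreal (max C1 C2)"
        using C1 y by (meson ennreal_leI max.cobounded1 order_trans)
      fix x assume "x \<in> {\<eta>0..y}" "0 < x"
      then show "b (x, y) \<le> max C1 C2"
        using C2[of x y] y by auto
    qed
  qed
  then obtain C where C: "\<And>n y. y \<in> {\<eta>0..\<eta>0 + real n} \<Longrightarrow> weighted_integral b w \<eta>0 y \<le> ennreal (C n)"
      "\<And>n x y. y \<in> {\<eta>0..\<eta>0 + real n} \<Longrightarrow> x \<in> {\<eta>0..y} \<Longrightarrow> 0 < x \<Longrightarrow> b (x, y) \<le> C n"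
    by metis
  obtain N where N_cont: "continuous_on {\<eta>0..} N" and N_pos: "\<And>y. \<eta>0 \<le> y \<Longrightarrow> 0 < N y"
    and N_ge: "\<And>y. \<eta>0 \<le> y \<Longrightarrow> C (nat \<lceil>y - \<eta>0\<rceil>) \<le> N y"
    using continuous_majorant_exists[of \<eta>0 C] by blast
  have y_mem: "y \<in> {\<eta>0..\<eta>0 + real (nat \<lceil>y - \<eta>0\<rceil>)}" if "\<eta>0 \<le> y" for y
    using that real_nat_ceiling_ge[of "y - \<eta>0"] unfolding atLeastAtMost_iff by linarith
  have N_weighted: "weighted_integral b w \<eta>0 y \<le> ennreal (N y)" if "\<eta>0 \<le> y" for y
    using C(1)[OF y_mem[OF that]] N_ge[OF that] by (meson ennreal_leI order_trans)
  have N_b: "b (x, y) \<le> N y" if "\<eta>0 \<le> x" "x \<le> y" "0 < x" for x y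
    using C(2)[OF y_mem, of y x] N_ge[of y] that by auto
  obtain v where v_cont: "continuous_on {\<eta>0..} v" and v_pos: "\<And>y. \<eta>0 \<le> y \<Longrightarrow> 0 < v y"
    and v_int: "\<And>y. \<eta>0 \<le> y \<Longrightarrow> (v has_integral (\<kappa> * v y / N y - 1)) {\<eta>0..y}"
    using linear_integral_equation_solution[OF N_cont N_pos kappa_pos] by blast
  define \<omega> where "\<omega> x = (if x < \<eta>0 then w x else v x)" for x
  have "weighted_integral b \<omega> y y \<le> ennreal (\<kappa> * \<omega> y)" if y: "\<eta>0 \<le> y" for y
  proof -
    let ?f = "\<lambda>x. ennreal (b (x, y) * \<omega> x)"
    \<comment> \<open>The point 0 is left out because \<open>N_b\<close> says nothing about
      \<open>b\<close> there.\<close>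
    let ?B = "{\<eta>0..<y} \<inter> {0<..}"
    have nonneg: "0 \<le> \<kappa> * v y / N y - 1"
      using v_int[OF y] by (rule has_integral_nonneg) (simp add: less_imp_le v_pos)
    have "weighted_integral b \<omega> y y \<le> (\<integral>\<^sup>+x\<in>{0<..<\<eta>0} \<union> ?B. ?f x \<partial>lebesgue)"
      unfolding weighted_integral_def by (intro nn_integral_mono) (auto simp: indicator_def)
    \<comment> \<open>The section of \<open>b\<close> at this \<open>y\<close> may be
      non-measurable, so only subadditivity over sets is invoked.\<close>
    also have "\<dots> \<le> (\<integral>\<^sup>+x\<in>{0<..<\<eta>0}. ?f x \<partial>lebesgue) + (\<integral>\<^sup>+x\<in>?B. ?f x \<partial>lebesgue)"
      by (rule nn_set_integral_Un_le) auto
    also have "(\<integral>\<^sup>+x\<in>{0<..<\<eta>0}. ?f x \<partial>lebesgue) = weighted_integral b w \<eta>0 y"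
      unfolding weighted_integral_def
      by (intro nn_integral_cong) (auto simp: indicator_def \<omega>_def)
    also have "\<dots> \<le> ennreal (N y)"
      by (rule N_weighted[OF y])
    \<comment> \<open>Replacing \<open>b (x, y)\<close> by \<open>N y\<close>, which is constant in
      \<open>x\<close>, leaves a multiple of the continuous \<open>v\<close>, whose integral is
      given exactly by \<open>v_int\<close>.\<close>
    also have "(\<integral>\<^sup>+x\<in>?B. ?f x \<partial>lebesgue) \<le> (\<integral>\<^sup>+x\<in>{\<eta>0..y}. ennreal (N y * v x) \<partial>lebesgue)"
    proof (rule nn_integral_mono)
      fix x
      have "b (x, y) * \<omega> x \<le> N y * v x" if "x \<in> ?B"
        using that N_b[of x y] v_pos[of x] by (auto simp: \<omega>_def intro!: mult_right_mono)
      then show "?f x * indicator ?B x \<le> ennreal (N y * v x) * indicator {\<eta>0..y} x"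
        by (auto simp: indicator_def intro!: ennreal_leI)
    qed
    also have "\<dots> = ennreal (N y * (\<kappa> * v y / N y - 1))"
      unfolding nn_integral_completion
      using N_pos[OF y] v_pos v_int[OF y]
      by (intro nn_integral_has_integral_lebesgue' has_integral_mult_right) (auto intro: less_imp_le)
    also have "ennreal (N y) + \<dots> = ennreal (N y + N y * (\<kappa> * v y / N y - 1))"
      using N_pos[OF y] nonneg by (intro ennreal_plus[symmetric]) auto
    \<comment> \<open>The equation solved by \<open>v\<close> makes the two bounds add up to exactly
      \<kappa> v(y).\<close>
    also have "N y + N y * (\<kappa> * v y / N y - 1) = \<kappa> * \<omega> y"
      using N_pos[OF y] y by (simp add: \<omega>_def field_simps)
    finally show ?thesis by (simp add: add_mono)
  qed
  moreover have "continuous_on {\<eta>0..} \<omega>"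
    using v_cont by (rule continuous_on_eq) (auto simp: \<omega>_def)
  moreover have "0 < \<omega> x" if "\<eta>0 \<le> x" for x
    using v_pos[OF that] that by (simp add: \<omega>_def)
  moreover have "\<omega> x = w x" if "x \<in> {0..<\<eta>0}" for x
    using that by (simp add: \<omega>_def)
  moreover have "0 \<le> \<omega> x" if "0 \<le> x" for x
    using that w_nonneg[of x] v_pos[of x] by (auto simp: \<omega>_def not_less intro: less_imp_le)
  ultimately show "\<exists>\<omega> :: real \<Rightarrow> real.
        (\<forall>x\<ge>0. 0 \<le> \<omega> x)
      \<and> (\<forall>x\<in>{0..<\<eta>0}. \<omega> x = w x)
      \<and> continuous_on {\<eta>0..} \<omega>
      \<and> (\<forall>x>\<eta>0. 0 < \<omega> x)
      \<and> (\<forall>y\<ge>\<eta>0. weighted_integral b \<omega> y y \<le> ennreal (\<kappa> * \<omega> y))"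
    by (intro exI[of _ \<omega>]) (auto intro: less_imp_le)
qed

end
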